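(* Let $N$ be an odd positive integer and let $\gamma$ be a real number with $0<\gamma<2$. Let $(P_n)_{0\le n\le N}$ be the finite sequence of monic para-Krawtchouk polynomials, that is, the polynomials defined by $P_{-1}(z)=0$, $P_0(z)=1$ and $$P_{n+1}(z)=(z-B_n)\,P_n(z)-C_n\,P_{n-1}(z),\qquad 0\le n<N,$$ with recurrence coefficients given, for $0\le n<N$, by $$B_n=\frac{N+\gamma-1}{2},\qquad C_{n+1}=-\frac{(n+1)(n-N)(2n+1-N-\gamma)(2n+1-N+\gamma)}{4(2n-N)(2n-N+2)}$$ (the value of $C_0$ is irrelevant since $P_{-1}=0$). Then for every $\mathfrak{c}_6\in\mathbb{C}$ the finite sequence $(P_n)_{0\le n\le N}$ is classical with respect to the linear lattice $x(s)=2s+\mathfrak{c}_6$. That is, there exist a linear functional $\mathbf{u}:\mathbb{C}[z]\to\mathbb{C}$, a nonzero polynomial $\phi$ of degree at most two and a polynomial $\psi$ of degree exactly one such that $\langle\mathbf{u},P_nP_m\rangle=0$ for all $0\le n,m\le N$ with $n\ne m$, $\langle\mathbf{u},P_n^2\rangle\neq 0$ for all $0\le n\le N$, and $$\mathbf{D}(\phi\,\mathbf{u})=\mathbf{S}(\psi\,\mathbf{u}),$$ where $\mathbf{D}$ and $\mathbf{S}$ are the $x$-derivative and the $x$-average on linear functionals associated with the lattice $x(s)=2s+\mathfrak{c}_6$.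
   Context: For the lattice $x:\mathbb{C}\to\mathbb{C}$, $x(s)=2s+\mathfrak{c}_6$, the $x$-derivative $\mathrm{D}$ and the $x$-average $\mathrm{S}$ are the linear operators on $\mathbb{C}[z]$ determined by $$\mathrm{D}p(x(s))=\frac{p\left(x\left(s+\frac12\right)\right)-p\left(x\left(s-\frac12\right)\right)}{x\left(s+\frac12\right)-x\left(s-\frac12\right)},\qquad \mathrm{S}p(x(s))=\frac12\,p\left(x\left(s+\tfrac12\right)\right)+\frac12\,p\left(x\left(s-\tfrac12\right)\right)$$ for all $s\in\mathbb{C}$. For a linear functional $\mathbf{v}:\mathbb{C}[z]\to\mathbb{C}$, write $\langle\mathbf{v},p\rangle$ for its value at the polynomial $p$. Multiplication by a polynomial, $x$-differentiation and $x$-averaging of functionals are defined by transposition: $$\langle q\mathbf{v},p\rangle=\langle\mathbf{v},qp\rangle,\qquad \langle\mathbf{D}\mathbf{v},p\rangle=-\langle\mathbf{v},\mathrm{D}p\rangle,\qquad \langle\mathbf{S}\mathbf{v},p\rangle=\langle\mathbf{v},\mathrm{S}p\rangle$$ for all polynomials $p,q$. A (finite) sequence of polynomials $(P_n)$ with $\deg P_n=n$ is orthogonal with respect to a linear functional $\mathbf{u}$ if $\langle\mathbf{u},P_nP_m\rangle$ is zero for $n\ne m$ and nonzero for $n=m$, for all indices in the range considered. It is called classical with respect to the lattice $x$ if it is orthogonal with respect to a functional $\mathbf{u}$ satisfying $\mathbf{D}(\phi\,\mathbf{u})=\mathbf{S}(\psi\,\mathbf{u})$ with $\phi$ a nonzero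 polynomial of degree at most two and $\psi$ a polynomial of degree exactly one, both independent of $n$. *)

theory Defs
  imports Complex_Main "HOL-Computational_Algebra.Polynomial"
begin

definition lin_lattice :: "complex \<Rightarrow> complex \<Rightarrow> complex" where
  "lin_lattice c6 s = 2 * s + c6"

text \<open>
  The operators below are determined by their values along a lattice \<open>x\<close>. The definite
  descriptions are meaningful when the polynomial described exists and is unique; for the linear
  lattice this is the content of \<open>x_deriv_ex1\<close> and \<open>x_avg_ex1\<close>.
\<close>

definition x_deriv :: "(complex \<Rightarrow> complex) \<Rightarrow> complex poly \<Rightarrow> complex poly" where
  "x_deriv x p = (THE q. \<forall>s. poly q (x s) =
     (poly p (x (s + 1/2)) - poly p (x (s - 1/2))) / (x (s + 1/2) - x (s - 1/2)))"

definition x_avg :: "(complex \<Rightarrow> complex) \<Rightarrow> complex poly \<Rightarrow> complex poly" where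
  "x_avg x p = (THE q. \<forall>s. poly q (x s) =
     1/2 * poly p (x (s + 1/2)) + 1/2 * poly p (x (s - 1/2)))"

lemma poly_eq_on_lin_lattice:
  assumes "\<And>s. poly p (lin_lattice c6 s) = poly q (lin_lattice c6 s)"
  shows "p = q"
proof -
  have "poly p z = poly q z" for z
  proof -
    have "lin_lattice c6 ((z - c6) / 2) = z"
      by (simp add: lin_lattice_def diff_divide_distrib)
    then show ?thesis
      using assms[of "(z - c6) / 2"] by simp
  qed
  then show ?thesis
    by (simp add: poly_eq_poly_eq_iff[symmetric] fun_eq_iff)
qed

lemma x_deriv_ex1:
  fixes c6 :: complex
  defines "x \<equiv> lin_lattice c6"
  shows "\<exists>!q. \<forall>s. poly q (x s) =
    (poly p (x (s + 1/2)) - poly p (x (s - 1/2))) / (x (s + 1/2) - x (s - 1/2))"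
proof (rule ex_ex1I)
  let ?q = "smult (1/2) (pcompose p [:1, 1:] - pcompose p [:-1, 1:])"
  have "poly ?q (x s) =
    (poly p (x (s + 1/2)) - poly p (x (s - 1/2))) / (x (s + 1/2) - x (s - 1/2))" for s
    by (simp add: x_def lin_lattice_def poly_pcompose algebra_simps)
  then show "\<exists>q. \<forall>s. poly q (x s) =
    (poly p (x (s + 1/2)) - poly p (x (s - 1/2))) / (x (s + 1/2) - x (s - 1/2))"
    by blast
qed (metis x_def poly_eq_on_lin_lattice)

lemma x_avg_ex1:
  fixes c6 :: complex
  defines "x \<equiv> lin_lattice c6"
  shows "\<exists>!q. \<forall>s. poly q (x s) = 1/2 * poly p (x (s + 1/2)) + 1/2 * poly p (x (s - 1/2))"
proof (rule ex_ex1I)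
  let ?q = "smult (1/2) (pcompose p [:1, 1:] + pcompose p [:-1, 1:])"
  have "poly ?q (x s) = 1/2 * poly p (x (s + 1/2)) + 1/2 * poly p (x (s - 1/2))" for s
    by (simp add: x_def lin_lattice_def poly_pcompose algebra_simps)
  then show "\<exists>q. \<forall>s. poly q (x s) = 1/2 * poly p (x (s + 1/2)) + 1/2 * poly p (x (s - 1/2))"
    by blast
qed (metis x_def poly_eq_on_lin_lattice)

definition linear_functional :: "(complex poly \<Rightarrow> complex) \<Rightarrow> bool" where
  "linear_functional u \<longleftrightarrow> Vector_Spaces.linear smult (*) u"

lemma linear_functional_iff:
  "linear_functional u \<longleftrightarrow>
     (\<forall>p q. u (p + q) = u p + u q) \<and> (\<forall>c p. u (smult c p) = c * u p)"
  unfolding linear_functional_def Vector_Spaces.linear_iff vector_space_def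
  by (auto simp: algebra_simps smult_add_right smult_add_left)

definition fun_mult ::
  "complex poly \<Rightarrow> (complex poly \<Rightarrow> complex) \<Rightarrow> complex poly \<Rightarrow> complex" where
  "fun_mult q v = (\<lambda>p. v (q * p))"

definition fun_x_deriv ::
  "(complex \<Rightarrow> complex) \<Rightarrow> (complex poly \<Rightarrow> complex) \<Rightarrow> complex poly \<Rightarrow> complex" where
  "fun_x_deriv x v = (\<lambda>p. - v (x_deriv x p))"

definition fun_x_avg ::
  "(complex \<Rightarrow> complex) \<Rightarrow> (complex poly \<Rightarrow> complex) \<Rightarrow> complex poly \<Rightarrow> complex" where
  "fun_x_avg x v = (\<lambda>p. v (x_avg x p))"

definition orthogonal_upto ::
  "nat \<Rightarrow> (nat \<Rightarrow> complex poly) \<Rightarrow> (complex poly \<Rightarrow> complex) \<Rightarrow> bool" where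
  "orthogonal_upto N P u \<longleftrightarrow>
     (\<forall>n\<le>N. degree (P n) = n) \<and>
     (\<forall>n\<le>N. \<forall>m\<le>N. n \<noteq> m \<longrightarrow> u (P n * P m) = 0) \<and>
     (\<forall>n\<le>N. u (P n * P n) \<noteq> 0)"

definition classical_upto ::
  "(complex \<Rightarrow> complex) \<Rightarrow> nat \<Rightarrow> (nat \<Rightarrow> complex poly) \<Rightarrow> bool" where
  "classical_upto x N P \<longleftrightarrow>
     (\<exists>u \<phi> \<psi>. linear_functional u \<and> orthogonal_upto N P u \<and>
        \<phi> \<noteq> 0 \<and> degree \<phi> \<le> 2 \<and> degree \<psi> = 1 \<and>
        fun_x_deriv x (fun_mult \<phi> u) = fun_x_avg x (fun_mult \<psi> u))"

definition pk_B :: "nat \<Rightarrow> real \<Rightarrow> nat \<Rightarrow> real" where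
  "pk_B N \<gamma> n = (real N + \<gamma> - 1) / 2"

text \<open>\<open>pk_C_Suc N \<gamma> n\<close> is the coefficient $C_{n+1}$.\<close>

definition pk_C_Suc :: "nat \<Rightarrow> real \<Rightarrow> nat \<Rightarrow> real" where
  "pk_C_Suc N \<gamma> n =
     - ((real n + 1) * (real n - real N)
         * (2 * real n + 1 - real N - \<gamma>) * (2 * real n + 1 - real N + \<gamma>))
       / (4 * (2 * real n - real N) * (2 * real n - real N + 2))"

text \<open>
  The recurrence is run for all indices, but only the entries of index at most \<open>N\<close> are the monic
  para-Krawtchouk polynomials.
\<close>

fun para_krawtchouk :: "nat \<Rightarrow> real \<Rightarrow> nat \<Rightarrow> complex poly" where
  "para_krawtchouk N \<gamma> 0 = 1"
| "para_krawtchouk N \<gamma> (Suc 0) = [:- of_real (pk_B N \<gamma> 0), 1:]"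
| "para_krawtchouk N \<gamma> (Suc (Suc n)) =
     [:- of_real (pk_B N \<gamma> (Suc n)), 1:] * para_krawtchouk N \<gamma> (Suc n)
     - smult (of_real (pk_C_Suc N \<gamma> n)) (para_krawtchouk N \<gamma> n)"

end

theory Submission
  imports Defs
begin

text \<open>
  With \<open>t = z - \<beta>\<close>, \<open>\<beta> = (N + \<gamma> - 1) / 2\<close>, \<open>\<mu> = N - 1\<close> and \<open>\<kappa> = ((N - 1)\<^sup>2 - \<gamma>\<^sup>2) / 4\<close>, the
  polynomials \<open>P\<^sub>n\<close> are eigenfunctions, with eigenvalues \<open>4 n (n - N)\<close>, of the difference operator
  \<open>L p(z) = A(z) (p(z + 2) - p(z)) + A'(z) (p(z - 2) - p(z))\<close>, where \<open>A = t\<^sup>2 - \<mu> t + \<kappa>\<close> and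
  \<open>A' = t\<^sup>2 + \<mu> t + \<kappa>\<close>. This follows from the recurrence by an induction that carries along the
  action of the commutator of \<open>L\<close> with multiplication by \<open>t\<close>.
  The functional \<open>u\<close> with \<open>u P\<^sub>0 = 1\<close> and \<open>u P\<^sub>n = 0\<close> for \<open>n > 0\<close> makes the \<open>P\<^sub>n\<close> orthogonal (Favard),
  and it annihilates the range of \<open>L\<close>, because the eigenvalue of \<open>P\<^sub>0\<close> is zero. As \<open>L\<close> factors
  as \<open>4 (\<psi> S + \<phi> D) D\<close> with \<open>\<phi> = t\<^sup>2 + \<kappa>\<close> and \<open>\<psi> = - \<mu> t\<close>, and \<open>D\<close> is onto, the functional equation
  follows. For \<open>N = 1\<close> this \<open>\<psi>\<close> vanishes, and instead \<open>u p = p(\<beta> + 1) + p(\<beta> - 1)\<close> with \<open>\<phi> = 1\<close> and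
  \<open>\<psi> = - t\<close> works.
\<close>

section \<open>Linear functionals on polynomials\<close>

lemma poly_ext_iff: "p = q \<longleftrightarrow> (\<forall>z. poly p z = poly q z)" for p q :: "complex poly"
  by (metis poly_eq_poly_eq_iff ext)

lemma linear_functional_0: "linear_functional u \<Longrightarrow> u 0 = 0"
  by (metis linear_functional_iff mult_zero_left smult_0_left)

lemma linear_functional_diff:
  assumes "linear_functional u"
  shows "u (p - q) = u p - u q"
proof -
  have "u p = u ((p - q) + q)" by simp
  also have "\<dots> = u (p - q) + u q" using assms by (metis linear_functional_iff)
  finally show ?thesis by simp
qed

text \<open>Subtracting a multiple of \<open>Q n\<close> lowers the degree without changing the
  value of \<open>u\<close>.\<close>

lemma linear_functional_eq_0:
  assumes u: "linear_functional u"
    and deg: "\<And>n. degree (Q n) = n" and lc: "\<And>n. coeff (Q n) n \<noteq> 0"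
    and Q0: "\<And>n. u (Q n) = 0"
  shows "u p = 0"
proof (induction "degree p" arbitrary: p rule: less_induct)
  case less
  define n where "n = degree p"
  define r where "r = p - smult (coeff p n / coeff (Q n) n) (Q n)"
  have p: "p = r + smult (coeff p n / coeff (Q n) n) (Q n)" by (simp add: r_def)
  have ur: "u p = u r"
    using u Q0 by (subst p) (simp add: linear_functional_iff)
  have c: "coeff r n = 0" using lc by (simp add: r_def)
  have d: "degree r \<le> n"
    unfolding r_def by (intro degree_diff_le) (auto simp: n_def deg intro: order_trans[OF degree_smult_le])
  show ?case
  proof (cases "degree r < n")
    case True
    then show ?thesis using less ur by (simp add: n_def)
  next
    case False
    then have "r = 0" using c d by (metis le_neq_implies_less leading_coeff_0_iff)
    then show ?thesis using ur linear_functional_0[OF u] by simp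
  qed
qed

text \<open>The moments are chosen one after the other so that \<open>P\<^sub>n\<close> is annihilated for \<open>n > 0\<close>.\<close>

fun moment :: "(nat \<Rightarrow> complex poly) \<Rightarrow> nat \<Rightarrow> complex" where
  "moment P n = (if n = 0 then 1 else - (\<Sum>i<n. coeff (P n) i * moment P i))"

declare moment.simps [simp del]

definition moment_functional :: "(nat \<Rightarrow> complex poly) \<Rightarrow> complex poly \<Rightarrow> complex" where
  "moment_functional P p = (\<Sum>i\<le>degree p. coeff p i * moment P i)"

lemma moment_functional_eq:
  assumes "degree p \<le> n"
  shows "moment_functional P p = (\<Sum>i\<le>n. coeff p i * moment P i)"
  unfolding moment_functional_def
  using assms by (intro sum.mono_neutral_left) (auto simp: coeff_eq_0)

lemma linear_moment_functional: "linear_functional (moment_functional P)"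
  unfolding linear_functional_iff
proof (intro conjI allI)
  fix p q :: "complex poly"
  let ?n = "max (degree p) (degree q)"
  show "moment_functional P (p + q) = moment_functional P p + moment_functional P q"
    by (simp add: moment_functional_eq[of _ ?n] degree_add_le_max sum.distrib ring_distribs)
next
  fix c :: complex and p
  show "moment_functional P (smult c p) = c * moment_functional P p"
    by (simp add: moment_functional_eq[of _ "degree p"] degree_smult_le sum_distrib_left mult.assoc)
qed

lemma moment_functional_basis:
  assumes "degree (P n) = n" "coeff (P n) n = 1"
  shows "moment_functional P (P n) = (if n = 0 then 1 else 0)"
proof -
  have "moment_functional P (P n) = (\<Sum>i<n. coeff (P n) i * moment P i) + moment P n"
    using assms by (simp add: moment_functional_def lessThan_Suc_atMost[symmetric])
  then show ?thesis by (subst (asm) (2) moment.simps) simp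
qed

section \<open>Orthogonality from a three-term recurrence\<close>

text \<open>With \<open>C 0 = 0\<close> the truncated index \<open>n - 1\<close> is harmless at \<open>n = 0\<close>.\<close>

locale three_term =
  fixes P :: "nat \<Rightarrow> complex poly" and B C :: "nat \<Rightarrow> complex"
  assumes P_0: "P 0 = 1" and C_0: "C 0 = 0"
    and P_Suc: "\<And>n. P (Suc n) = [:- B n, 1:] * P n - smult (C n) (P (n - 1))"
begin

lemma monic: "degree (P n) = n \<and> coeff (P n) n = 1"
proof (induction n rule: less_induct)
  case (less n)
  show ?case
  proof (cases n)
    case 0
    then show ?thesis by (simp add: P_0)
  next
    case (Suc k)
    have k: "degree (P k) = k" "coeff (P k) k = 1" "degree (P (k - 1)) = k - 1"
      using less[of k] less[of "k - 1"] Suc by auto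
    have "coeff (P (Suc k)) (Suc k) = 1"
      using k by (simp add: P_Suc coeff_eq_0 coeff_pCons)
    moreover have "degree (P (Suc k)) \<le> Suc k"
      unfolding P_Suc
      by (intro degree_diff_le order_trans[OF degree_mult_le] order_trans[OF degree_smult_le])
        (use k in auto)
    ultimately show ?thesis
      using Suc by (metis le_antisym le_degree zero_neq_one)
  qed
qed

lemma degree_P: "degree (P n) = n" and coeff_P: "coeff (P n) n = 1"
  using monic by auto

text \<open>Induction on \<open>n\<close>: multiplication by z moves from \<open>P k\<close> onto
  \<open>P m\<close>, where the recurrence expands it.\<close>

lemma functional_product:
  assumes u: "linear_functional u" and uP: "\<And>n. u (P n) = (if n = 0 then 1 else 0)"
  shows "u (P n * P m) = (if n = m then \<Prod>i\<in>{1..n}. C i else 0)"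
proof (induction n arbitrary: m rule: less_induct)
  case (less n)
  show ?case
  proof (cases n)
    case 0
    then show ?thesis by (simp add: P_0 uP)
  next
    case (Suc k)
    have IH: "u (P k * P j) = (if k = j then \<Prod>i\<in>{1..k}. C i else 0)" for j
      using less[of k] Suc by simp
    \<comment> \<open>The factor \<open>C k\<close> covers \<open>k = 0\<close> and extends the
      product from \<open>k - 1\<close> to \<open>k\<close>.\<close>
    have IH': "C k * u (P (k - 1) * P j) = (if k = Suc j then \<Prod>i\<in>{1..k}. C i else 0)" for j
    proof (cases k)
      case 0
      then show ?thesis by (simp add: C_0)
    next
      case (Suc l)
      then show ?thesis using less[of l] \<open>n = Suc k\<close> by (simp add: mult.commute)
    qed
    have X: "[:0, 1:] * P j = P (Suc j) + smult (B j) (P j) + smult (C j) (P (j - 1))" for j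
      by (simp add: P_Suc poly_ext_iff algebra_simps)
    have "P n * P m = P k * ([:0, 1:] * P m) - smult (B k) (P k * P m) - smult (C k) (P (k - 1) * P m)"
      by (simp add: Suc P_Suc poly_ext_iff algebra_simps)
    also have "\<dots> = P k * P (Suc m) + smult (B m) (P k * P m) + smult (C m) (P k * P (m - 1))
        - smult (B k) (P k * P m) - smult (C k) (P (k - 1) * P m)"
      unfolding X by (simp add: algebra_simps)
    finally have "u (P n * P m) = u (P k * P (Suc m)) + B m * u (P k * P m) + C m * u (P k * P (m - 1))
        - B k * u (P k * P m) - C k * u (P (k - 1) * P m)"
      using u by (simp add: linear_functional_diff linear_functional_iff)
    then show ?thesis
      unfolding IH IH' using Suc by (cases m) (auto simp: C_0)
  qed
qed

end

section \<open>The difference equation\<close>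

definition shift_poly :: "complex \<Rightarrow> complex poly \<Rightarrow> complex poly" where
  "shift_poly h p = pcompose p [:h, 1:]"

lemma poly_shift_poly [simp]: "poly (shift_poly h p) z = poly p (z + h)"
  by (simp add: shift_poly_def poly_pcompose add.commute)

text \<open>\<open>C_Suc\<close> is the vanishing of the coefficient of \<open>P n\<close> when the
  formula for \<open>M\<close> in \<open>L_M_P\<close> passes from \<open>n\<close> to
  \<open>Suc n\<close>.\<close>

locale symmetric_three_term = three_term P "\<lambda>_. \<beta>" C for P \<beta> C +
  fixes N \<kappa> :: complex
  assumes C_Suc: "\<And>n. (2 * of_nat n + 2 - N) * C (Suc n) - (2 * of_nat n - 2 - N) * C n
    + 2 * of_nat n * (of_nat n - N) + \<kappa> = 0"
begin

definition A_plus :: "complex poly" where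
  "A_plus = [:-\<beta>, 1:]\<^sup>2 - smult (N - 1) [:-\<beta>, 1:] + [:\<kappa>:]"

definition A_minus :: "complex poly" where
  "A_minus = [:-\<beta>, 1:]\<^sup>2 + smult (N - 1) [:-\<beta>, 1:] + [:\<kappa>:]"

definition L :: "complex poly \<Rightarrow> complex poly" where
  "L p = A_plus * (shift_poly 2 p - p) + A_minus * (shift_poly (-2) p - p)"

text \<open>The commutator of \<open>L\<close> and multiplication by \<open>z - \<beta>\<close>.\<close>

definition M :: "complex poly \<Rightarrow> complex poly" where
  "M p = smult 2 (A_plus * shift_poly 2 p - A_minus * shift_poly (-2) p)"

lemma L_P_Suc: "L (P (Suc n)) = [:-\<beta>, 1:] * L (P n) + M (P n) - smult (C n) (L (P (n - 1)))"
  by (simp add: P_Suc L_def M_def poly_ext_iff algebra_simps)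

text \<open>Commuting a second time closes the system: the commutator of \<open>M\<close> with z -
  \<beta> is 4 \<open>L\<close> plus a multiplication, as \<open>A_plus\<close> and
  \<open>A_minus\<close> add up to 2((z - \<beta>)^2 + \<kappa>).\<close>

lemma M_P_Suc: "M (P (Suc n)) = [:-\<beta>, 1:] * M (P n) + smult 4 (L (P n))
    + smult 8 (([:-\<beta>, 1:]\<^sup>2 + [:\<kappa>:]) * P n) - smult (C n) (M (P (n - 1)))"
  by (simp add: P_Suc L_def M_def A_plus_def A_minus_def poly_ext_iff algebra_simps power2_eq_square)

text \<open>The coefficients in \<open>M (P n)\<close> are differences of neighbouring eigenvalues
  of \<open>L\<close>.\<close>

lemma L_M_P:
  "L (P n) = smult (4 * of_nat n * (of_nat n - N)) (P n) \<and>
   M (P n) = smult (4 * (2 * of_nat n + 1 - N)) (P (Suc n))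
     - smult (C n * (4 * (2 * of_nat n - 1 - N))) (P (n - 1))"
proof (induction n rule: less_induct)
  case (less n)
  show ?case
  proof (cases n)
    case 0
    then show ?thesis
      by (simp add: P_0 C_0 P_Suc L_def M_def A_plus_def A_minus_def poly_ext_iff algebra_simps power2_eq_square)
  next
    case (Suc k)
    have k: "L (P k) = smult (4 * of_nat k * (of_nat k - N)) (P k)"
      "M (P k) = smult (4 * (2 * of_nat k + 1 - N)) (P (Suc k))
        - smult (C k * (4 * (2 * of_nat k - 1 - N))) (P (k - 1))"
      using less[of k] Suc by auto
    have k': "smult (C k) (L (P (k - 1))) = smult (C k * (4 * (of_nat k - 1) * (of_nat k - 1 - N))) (P (k - 1)) \<and>
      smult (C k) (M (P (k - 1))) = smult (C k * (4 * (2 * of_nat k - 1 - N))) (P k)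
       - smult (C k * C (k - 1) * (4 * (2 * of_nat k - 3 - N))) (P (k - 2))"
    proof (cases k)
      case 0
      then show ?thesis by (simp add: C_0)
    next
      case (Suc j)
      then have LP: "L (P j) = smult (4 * of_nat j * (of_nat j - N)) (P j)"
        and MP: "M (P j) = smult (4 * (2 * of_nat j + 1 - N)) (P (Suc j))
          - smult (C j * (4 * (2 * of_nat j - 1 - N))) (P (j - 1))"
        using less[of j] \<open>n = Suc k\<close> by auto
      show ?thesis
        unfolding Suc diff_Suc_1 LP MP by (simp add: poly_ext_iff algebra_simps)
    qed
    have P1: "poly (P (Suc k)) z = (z - \<beta>) * poly (P k) z - C k * poly (P (k - 1)) z" for z
      by (simp add: P_Suc algebra_simps)
    have P2: "poly (P (Suc (Suc k))) z = (z - \<beta>) * poly (P (Suc k)) z - C (Suc k) * poly (P k) z" for z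
      by (subst P_Suc) (simp add: algebra_simps)
    \<comment> \<open>The recurrence one index lower, scaled by \<open>C k\<close> so that it
      survives truncation at \<open>k = 0\<close>; it eliminates \<open>P (k - 2)\<close>.\<close>
    have P0: "C k * poly (P k) z = C k * ((z - \<beta>) * poly (P (k - 1)) z - C (k - 1) * poly (P (k - 2)) z)" for z
      using P_Suc[of "k - 1"] by (cases k) (simp_all add: C_0 numeral_2_eq_2 left_diff_distrib)
    have "L (P (Suc k)) = smult (4 * of_nat (Suc k) * (of_nat (Suc k) - N)) (P (Suc k))"
      unfolding L_P_Suc k k'[THEN conjunct1] by (simp add: poly_ext_iff P1 algebra_simps)
    moreover have "poly (M (P (Suc k))) z = 4 * (2 * of_nat (Suc k) + 1 - N) * poly (P (Suc (Suc k))) z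
        - C (Suc k) * (4 * (2 * of_nat (Suc k) - 1 - N)) * poly (P k) z" for z
    proof -
      have "poly (M (P (Suc k))) z - (4 * (2 * of_nat (Suc k) + 1 - N) * poly (P (Suc (Suc k))) z
          - C (Suc k) * (4 * (2 * of_nat (Suc k) - 1 - N)) * poly (P k) z)
        = 8 * poly (P k) z * ((2 * of_nat k + 2 - N) * C (Suc k) - (2 * of_nat k - 2 - N) * C k
            + 2 * of_nat k * (of_nat k - N) + \<kappa>)
          + (4 * (2 * of_nat k - 3 - N)) * (C k * poly (P k) z
            - C k * ((z - \<beta>) * poly (P (k - 1)) z - C (k - 1) * poly (P (k - 2)) z))"
        unfolding M_P_Suc k k'[THEN conjunct2] by (simp add: P1 P2) (simp add: algebra_simps power2_eq_square)
      then show ?thesis unfolding C_Suc P0[symmetric] by simp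
    qed
    ultimately show ?thesis using Suc by (simp add: poly_ext_iff)
  qed
qed

lemma L_P: "L (P n) = smult (4 * of_nat n * (of_nat n - N)) (P n)"
  using L_M_P by blast

lemma functional_L:
  assumes u: "linear_functional u" and uP: "\<And>n. n > 0 \<Longrightarrow> u (P n) = 0"
  shows "u (L p) = 0"
proof (rule linear_functional_eq_0[where u = "\<lambda>p. u (L p)" and Q = P])
  have "L (p + q) = L p + L q" "L (smult c p) = smult c (L p)" for c p q
    by (simp_all add: L_def poly_ext_iff algebra_simps)
  then show "linear_functional (\<lambda>p. u (L p))" using u by (simp add: linear_functional_iff)
  show "u (L (P n)) = 0" for n
    using u uP[of n] by (cases "n = 0") (simp_all add: L_P linear_functional_iff linear_functional_0)
qed (simp_all add: degree_P coeff_P)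

end

section \<open>The operators on the linear lattice\<close>

lemma x_deriv_lin_lattice:
  "x_deriv (lin_lattice c6) p = smult (1/2) (shift_poly 1 p - shift_poly (-1) p)"
  unfolding x_deriv_def
  by (rule the1_equality[OF x_deriv_ex1]) (simp add: lin_lattice_def algebra_simps)

lemma x_avg_lin_lattice:
  "x_avg (lin_lattice c6) p = smult (1/2) (shift_poly 1 p + shift_poly (-1) p)"
  unfolding x_avg_def
  by (rule the1_equality[OF x_avg_ex1]) (simp add: lin_lattice_def algebra_simps)

text \<open>D maps z^(n+1) to exact degree n, which makes it onto. S is tracked too because the
  product rules couple both operators.\<close>

lemma x_deriv_x_avg_monom:
  fixes c6 defines "x \<equiv> lin_lattice c6"
  shows "degree (x_avg x (monom 1 n)) \<le> n \<and> coeff (x_avg x (monom 1 n)) n = 1 \<and>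
    degree (x_deriv x (monom 1 (Suc n))) \<le> n \<and> coeff (x_deriv x (monom 1 (Suc n))) n = of_nat (Suc n)"
proof (induction n)
  case 0
  have "x_avg x (monom 1 0) = 1" "x_deriv x (monom 1 (Suc 0)) = 1"
    by (simp_all add: x_def x_deriv_lin_lattice x_avg_lin_lattice poly_ext_iff poly_monom)
  then show ?case by simp
next
  case (Suc n)
  \<comment> \<open>\<open>S(z p) = z S p + D p\<close> and \<open>D(z p) = z D p + S p\<close>\<close>
  have S: "x_avg x (monom 1 (Suc n)) = pCons 0 (x_avg x (monom 1 n)) + x_deriv x (monom 1 n)" for n
    by (simp add: x_def x_deriv_lin_lattice x_avg_lin_lattice poly_ext_iff poly_monom field_simps)
  have D: "x_deriv x (monom 1 (Suc n)) = pCons 0 (x_deriv x (monom 1 n)) + x_avg x (monom 1 n)" for n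
    by (simp add: x_def x_deriv_lin_lattice x_avg_lin_lattice poly_ext_iff poly_monom field_simps)
  \<comment> \<open>A crude bound, read off by solving \<open>D\<close> for its first
    summand.\<close>
  have d0: "degree (x_deriv x (monom 1 n)) \<le> n"
  proof -
    have "x_deriv x (monom 1 (Suc n)) - x_avg x (monom 1 n) = pCons 0 (x_deriv x (monom 1 n))"
      by (simp add: D)
    moreover have "degree (x_deriv x (monom 1 (Suc n)) - x_avg x (monom 1 n)) \<le> n"
      using Suc by (intro degree_diff_le) auto
    ultimately show ?thesis by (metis Suc_leD degree_0 degree_pCons_eq zero_le)
  qed
  have dS: "degree (x_avg x (monom 1 (Suc n))) \<le> Suc n"
    unfolding S using Suc d0
    by (intro degree_add_le order_trans[OF degree_pCons_le]) auto
  have cS: "coeff (x_avg x (monom 1 (Suc n))) (Suc n) = 1"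
    unfolding S using Suc d0 by (simp add: coeff_eq_0)
  have "degree (x_deriv x (monom 1 (Suc (Suc n)))) \<le> Suc n"
    unfolding D[of "Suc n"] using Suc dS
    by (intro degree_add_le order_trans[OF degree_pCons_le]) auto
  moreover have "coeff (x_deriv x (monom 1 (Suc (Suc n)))) (Suc n) = of_nat (Suc (Suc n))"
    unfolding D[of "Suc n"] using Suc cS by simp
  ultimately show ?case using dS cS by blast
qed

lemma linear_functional_eq_0_on_x_deriv:
  assumes "linear_functional v" and "\<And>q. v (x_deriv (lin_lattice c6) q) = 0"
  shows "v p = 0"
proof (rule linear_functional_eq_0[where Q = "\<lambda>n. x_deriv (lin_lattice c6) (monom 1 (Suc n))"])
  fix n
  note * = x_deriv_x_avg_monom[of c6 n]
  show c: "coeff (x_deriv (lin_lattice c6) (monom 1 (Suc n))) n \<noteq> 0"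
    using * by (metis of_nat_neq_0)
  show "degree (x_deriv (lin_lattice c6) (monom 1 (Suc n))) = n"
    using * c le_degree by (metis le_antisym)
qed (use assms in auto)

section \<open>Para-Krawtchouk polynomials\<close>

definition pk_C :: "nat \<Rightarrow> real \<Rightarrow> nat \<Rightarrow> complex" where
  "pk_C N \<gamma> n = (if n = 0 then 0 else of_real (pk_C_Suc N \<gamma> (n - 1)))"

lemma odd_nat_neq_real:
  assumes "odd N"
  shows "2 * real n \<noteq> real N" "2 * real n + 2 \<noteq> real N" "2 * real n - 2 \<noteq> real N"
proof -
  have "2 * int n \<noteq> int N" "2 * int n + 2 \<noteq> int N" "2 * int n - 2 \<noteq> int N"
    using assms by presburger+
  then show "2 * real n \<noteq> real N" "2 * real n + 2 \<noteq> real N" "2 * real n - 2 \<noteq> real N"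
    by linarith+
qed

text \<open>Each outer factor cancels one factor of a denominator, leaving the common denominator
  4(2n - N) and a polynomial identity.\<close>

lemma pk_C_Suc_rec:
  assumes "odd N"
  shows "(2 * real n + 2 - N) * pk_C_Suc N \<gamma> n
      - (2 * real n - 2 - N) * (if n = 0 then 0 else pk_C_Suc N \<gamma> (n - 1))
      + 2 * real n * (real n - N) + ((real N - 1)\<^sup>2 - \<gamma>\<^sup>2) / 4 = 0"
proof (cases n)
  case 0
  have "real N \<noteq> 0" "2 - real N \<noteq> 0"
    using odd_nat_neq_real[OF assms, of 0] by auto
  then show ?thesis
    using 0 by (simp add: pk_C_Suc_def divide_simps) (simp add: algebra_simps power2_eq_square)
next
  case (Suc k)
  define m where "m = real n"
  define d where "d = 2 * m - N"
  have nz: "d \<noteq> 0" "d + 2 \<noteq> 0" "d - 2 \<noteq> 0"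
    using odd_nat_neq_real[OF assms, of n] by (auto simp: d_def m_def)
  have N: "real N = 2 * m - d" by (simp add: d_def)
  have c1: "(2 * m + 2 - (2 * m - d)) * pk_C_Suc N \<gamma> n
      = - ((m + 1) * (d - m) * (d + 1 - \<gamma>) * (d + 1 + \<gamma>)) / (4 * d)"
    unfolding pk_C_Suc_def m_def[symmetric] N using nz
    by (simp add: divide_simps) (simp add: algebra_simps)
  have c0: "(2 * m - 2 - (2 * m - d)) * pk_C_Suc N \<gamma> (n - 1)
      = - (m * (d - m - 1) * (d - 1 - \<gamma>) * (d - 1 + \<gamma>)) / (4 * d)"
  proof -
    have "real (n - 1) = m - 1" using Suc by (simp add: m_def)
    then show ?thesis
      unfolding pk_C_Suc_def m_def[symmetric] N using nz
      by (simp add: divide_simps) (simp add: algebra_simps)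
  qed
  have "- ((m + 1) * (d - m) * (d + 1 - \<gamma>) * (d + 1 + \<gamma>)) / (4 * d)
      - - (m * (d - m - 1) * (d - 1 - \<gamma>) * (d - 1 + \<gamma>)) / (4 * d)
      + 2 * m * (m - (2 * m - d)) + ((2 * m - d - 1)\<^sup>2 - \<gamma>\<^sup>2) / 4 = 0"
    using nz by (simp add: divide_simps) (simp add: algebra_simps power2_eq_square)
  moreover have "(if n = 0 then 0 else pk_C_Suc N \<gamma> (n - 1)) = pk_C_Suc N \<gamma> (n - 1)"
    using Suc by simp
  ultimately show ?thesis
    by (simp only: c1 c0 N flip: m_def)
qed

text \<open>For odd \<open>N\<close> the integer 2n + 1 - N is even, so it cannot equal \<gamma> or
  -\<gamma>.\<close>

lemma pk_C_Suc_nonzero: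
  assumes "odd N" "0 < \<gamma>" "\<gamma> < 2" "n < N"
  shows "pk_C_Suc N \<gamma> n \<noteq> 0"
proof -
  obtain j where j: "N = 2 * j + 1" using assms(1) by (auto elim: oddE)
  have "n = j \<or> n + 1 \<le> j \<or> j + 1 \<le> n" by linarith
  then have "2 * real n + 1 - N = 0 \<or> 2 * real n + 1 - N \<le> -2 \<or> 2 * real n + 1 - N \<ge> 2"
    unfolding j by (elim disjE) auto
  then have "2 * real n + 1 - N - \<gamma> \<noteq> 0" "2 * real n + 1 - N + \<gamma> \<noteq> 0"
    using assms(2,3) by auto
  moreover have "2 * real n - N \<noteq> 0" "2 * real n - N + 2 \<noteq> 0"
    using odd_nat_neq_real[OF assms(1), of n] by auto
  ultimately show ?thesis using assms(4) by (simp add: pk_C_Suc_def)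
qed

lemma symmetric_three_term_para_krawtchouk:
  assumes "odd N"
  shows "symmetric_three_term (para_krawtchouk N \<gamma>) (of_real ((real N + \<gamma> - 1) / 2)) (pk_C N \<gamma>)
    (of_nat N) (of_real (((real N - 1)\<^sup>2 - \<gamma>\<^sup>2) / 4))"
proof unfold_locales
  fix n
  show "para_krawtchouk N \<gamma> (Suc n) = [:- of_real ((real N + \<gamma> - 1) / 2), 1:] * para_krawtchouk N \<gamma> n
      - smult (pk_C N \<gamma> n) (para_krawtchouk N \<gamma> (n - 1))"
    by (cases n) (simp_all add: pk_C_def pk_B_def)
  have "complex_of_real ((2 * real n + 2 - N) * pk_C_Suc N \<gamma> n
      - (2 * real n - 2 - N) * (if n = 0 then 0 else pk_C_Suc N \<gamma> (n - 1))
      + 2 * real n * (real n - N) + ((real N - 1)\<^sup>2 - \<gamma>\<^sup>2) / 4) = 0"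
    by (simp only: pk_C_Suc_rec[OF assms] of_real_0)
  then show "(2 * of_nat n + 2 - of_nat N) * pk_C N \<gamma> (Suc n) - (2 * of_nat n - 2 - of_nat N) * pk_C N \<gamma> n
      + 2 * of_nat n * (of_nat n - of_nat N) + complex_of_real (((real N - 1)\<^sup>2 - \<gamma>\<^sup>2) / 4) = 0"
    by (simp add: pk_C_def split: if_splits)
qed (simp_all add: pk_C_def)

lemma classical_upto_para_krawtchouk_1:
  "classical_upto (lin_lattice c6) 1 (para_krawtchouk 1 \<gamma>)"
proof -
  define \<beta> :: complex where "\<beta> = of_real (\<gamma> / 2)"
  define u :: "complex poly \<Rightarrow> complex" where "u = (\<lambda>p. poly p (\<beta> + 1) + poly p (\<beta> - 1))"
  define P where "P = para_krawtchouk 1 \<gamma>"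
  have P: "P 0 = 1" "P (Suc 0) = [:-\<beta>, 1:]"
    by (simp_all add: P_def pk_B_def \<beta>_def)
  have "linear_functional u"
    by (simp add: linear_functional_iff u_def algebra_simps)
  moreover have "orthogonal_upto 1 P u"
    unfolding orthogonal_upto_def
    by (auto simp: le_Suc_eq P u_def)
  \<comment> \<open>Both sides are (p(\<beta> - 2) - p(\<beta> + 2))/2; the values at \<beta>
    cancel.\<close>
  moreover have "fun_x_deriv (lin_lattice c6) (fun_mult 1 u) = fun_x_avg (lin_lattice c6) (fun_mult [:\<beta>, -1:] u)"
    by (rule ext) (simp add: fun_x_deriv_def fun_x_avg_def fun_mult_def u_def
      x_deriv_lin_lattice x_avg_lin_lattice field_simps)
  moreover have "degree [:\<beta>, -1:] = 1" by simp
  ultimately show ?thesis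
    unfolding classical_upto_def P_def by (metis degree_1 one_neq_zero zero_le)
qed

theorem mainTheorem1:
  fixes N :: nat and \<gamma> :: real and c6 :: complex
  assumes "odd N" and "0 < \<gamma>" and "\<gamma> < 2"
  shows "classical_upto (lin_lattice c6) N (para_krawtchouk N \<gamma>)"
proof (cases "N = 1")
  case True
  then show ?thesis using classical_upto_para_krawtchouk_1 by blast
next
  case False
  define P where "P = para_krawtchouk N \<gamma>"
  define \<beta> :: complex where "\<beta> = of_real ((real N + \<gamma> - 1) / 2)"
  define \<kappa> :: complex where "\<kappa> = of_real (((real N - 1)\<^sup>2 - \<gamma>\<^sup>2) / 4)"
  interpret symmetric_three_term P \<beta> "pk_C N \<gamma>" "of_nat N" \<kappa>
    unfolding P_def \<beta>_def \<kappa>_def by (rule symmetric_three_term_para_krawtchouk[OF assms(1)])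
  define u where "u = moment_functional P"
  have u: "linear_functional u" unfolding u_def by (rule linear_moment_functional)
  have uP: "u (P n) = (if n = 0 then 1 else 0)" for n
    unfolding u_def by (rule moment_functional_basis) (simp_all add: degree_P coeff_P)
  have "orthogonal_upto N P u"
    unfolding orthogonal_upto_def functional_product[OF u uP]
    using pk_C_Suc_nonzero[OF assms] by (auto simp: degree_P pk_C_def)
  \<comment> \<open>\<phi> and \<psi> are half the sum and half the difference of
    \<open>A_plus\<close> and \<open>A_minus\<close>.\<close>
  moreover define \<phi> where "\<phi> = [:-\<beta>, 1:]\<^sup>2 + [:\<kappa>:]"
  define \<psi> where "\<psi> = smult (1 - of_nat N) [:-\<beta>, 1:]"
  have \<phi>: "\<phi> = [:\<beta>\<^sup>2 + \<kappa>, - 2 * \<beta>, 1:]"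
    by (simp add: \<phi>_def power2_eq_square)
  have \<phi>1: "\<phi> \<noteq> 0" and \<phi>2: "degree \<phi> \<le> 2" by (simp_all add: \<phi>)
  have "of_nat N \<noteq> (1 :: complex)" using False by simp
  then have \<psi>: "degree \<psi> = 1" by (simp add: \<psi>_def)
  let ?x = "lin_lattice c6"
  \<comment> \<open>This is the functional equation transposed; it suffices to test p = D q, where
    the argument of \<open>u\<close> becomes a quarter of \<open>L q\<close>.\<close>
  have "u (\<psi> * x_avg ?x p + \<phi> * x_deriv ?x p) = 0" for p
  proof (rule linear_functional_eq_0_on_x_deriv[where v = "\<lambda>p. u (\<psi> * x_avg ?x p + \<phi> * x_deriv ?x p)"])
    have lin: "\<psi> * x_avg ?x (p + q) + \<phi> * x_deriv ?x (p + q)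
        = (\<psi> * x_avg ?x p + \<phi> * x_deriv ?x p) + (\<psi> * x_avg ?x q + \<phi> * x_deriv ?x q)"
      "\<psi> * x_avg ?x (smult c p) + \<phi> * x_deriv ?x (smult c p)
        = smult c (\<psi> * x_avg ?x p + \<phi> * x_deriv ?x p)" for p q c
      by (simp_all add: x_deriv_lin_lattice x_avg_lin_lattice poly_ext_iff field_simps)
    show "linear_functional (\<lambda>p. u (\<psi> * x_avg ?x p + \<phi> * x_deriv ?x p))"
      using u unfolding linear_functional_iff lin by simp
    fix q
    have "\<psi> * x_avg ?x (x_deriv ?x q) + \<phi> * x_deriv ?x (x_deriv ?x q) = smult (1/4) (L q)"
      by (simp add: x_deriv_lin_lattice x_avg_lin_lattice poly_ext_iff \<psi>_def \<phi>_def L_def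
          A_plus_def A_minus_def) (simp add: field_simps power2_eq_square)
    then show "u (\<psi> * x_avg ?x (x_deriv ?x q) + \<phi> * x_deriv ?x (x_deriv ?x q)) = 0"
      using functional_L[OF u, of q] uP u by (simp add: linear_functional_iff)
  qed
  then have "fun_x_deriv ?x (fun_mult \<phi> u) = fun_x_avg ?x (fun_mult \<psi> u)"
    using u by (auto simp: fun_x_deriv_def fun_x_avg_def fun_mult_def linear_functional_iff
        fun_eq_iff eq_neg_iff_add_eq_0 neg_eq_iff_add_eq_0 add.commute)
  ultimately show ?thesis
    using u \<phi>1 \<phi>2 \<psi> unfolding classical_upto_def P_def by blast
qed

end
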